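(* Let $w:[0,1) \to (0,1)$ be any decreasing function satisfying $\lim_{t \to 1^-} w(t) = 0$. Then there exist a singular inner function $\theta$ and a sequence of analytic polynomials $\{p_n\}_n$ such that (i) $\lim_{n \to \infty} \theta(z) p_n(z) = 1$ for every $z \in \mathbb{D}$, and (ii) $\sup_{z \in \mathbb{D}} |\theta(z) p_n(z)|\, w(|z|) \leq 2$ for every $n$.
   Context: $\mathbb{D} = \{z \in \mathbb{C} : |z|<1\}$ is the unit disk and $\mathbb{T} = \{z \in \mathbb{C} : |z|=1\}$ is the unit circle. A singular inner function is a function of the form $$\theta(z) = S_\nu(z) = \exp\Big(-\int_{\mathbb{T}} \frac{\zeta+z}{\zeta-z}\, d\nu(\zeta)\Big), \quad z \in \mathbb{D},$$ where $\nu$ is a non-zero positive finite Borel measure on $\mathbb{T}$ which is singular with respect to Lebesgue measure. An analytic polynomial is a polynomial in $z$ with complex coefficients. "Decreasing" is understood in the non-strict sense. *)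

theory Defs
  imports "HOL-Analysis.Analysis" "HOL-Computational_Algebra.Polynomial"
begin

abbreviation unit_disk :: "complex set" where
  "unit_disk \<equiv> ball 0 1"

abbreviation unit_circle :: "complex set" where
  "unit_circle \<equiv> sphere 0 1"

abbreviation circle_borel :: "complex measure" where
  "circle_borel \<equiv> restrict_space borel unit_circle"

text \<open>Arc length, of total mass \<open>2 * pi\<close>. The normalisation is immaterial here, since only
  its null sets matter for singularity.\<close>

definition circle_lebesgue :: "complex measure" where
  "circle_lebesgue = distr (restrict_space lborel {0..<2 * pi}) circle_borel cis"

definition mutually_singular :: "'a measure \<Rightarrow> 'a measure \<Rightarrow> bool" where
  "mutually_singular M N \<longleftrightarrow>
     sets M = sets N \<and>
     (\<exists>A\<in>sets M. emeasure M A = 0 \<and> emeasure N (space N - A) = 0)"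

definition singular_circle_measure :: "complex measure \<Rightarrow> bool" where
  "singular_circle_measure \<nu> \<longleftrightarrow>
     sets \<nu> = sets circle_borel \<and> finite_measure \<nu> \<and>
     emeasure \<nu> (space \<nu>) \<noteq> 0 \<and> mutually_singular \<nu> circle_lebesgue"

definition singular_S :: "complex measure \<Rightarrow> complex \<Rightarrow> complex" where
  "singular_S \<nu> z = exp (- (LINT \<zeta>|\<nu>. (\<zeta> + z) / (\<zeta> - z)))"

text \<open>HOL functions are total, so only the values on the disk are constrained.\<close>

definition singular_inner :: "(complex \<Rightarrow> complex) \<Rightarrow> bool" where
  "singular_inner \<theta> \<longleftrightarrow>
     (\<exists>\<nu>. singular_circle_measure \<nu> \<and> (\<forall>z\<in>unit_disk. \<theta> z = singular_S \<nu> z))"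

lemma measurable_cis_circle: "cis \<in> restrict_space lborel A \<rightarrow>\<^sub>M circle_borel"
proof (rule measurable_restrict_space2)
  show "cis \<in> space (restrict_space lborel A) \<rightarrow> unit_circle"
    by (auto simp: dist_norm)
  have "cis \<in> borel_measurable lborel"
    by (simp add: borel_measurable_continuous_onI continuous_intros)
  then show "cis \<in> restrict_space lborel A \<rightarrow>\<^sub>M borel"
    by (rule measurable_restrict_space1)
qed

lemma sets_circle_lebesgue [simp]: "sets circle_lebesgue = sets circle_borel"
  by (simp add: circle_lebesgue_def)

lemma space_circle_lebesgue [simp]: "space circle_lebesgue = unit_circle"
  by (simp add: circle_lebesgue_def space_restrict_space)

lemma emeasure_circle_lebesgue:
  assumes "B \<in> sets circle_borel"
  shows "emeasure circle_lebesgue B = emeasure lborel {t \<in> {0..<2 * pi}. cis t \<in> B}"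
proof -
  have "emeasure circle_lebesgue B =
      emeasure (restrict_space lborel {0..<2 * pi}) (cis -` B \<inter> {0..<2 * pi})"
    using emeasure_distr[OF measurable_cis_circle assms]
    by (simp add: circle_lebesgue_def space_restrict_space)
  also have "\<dots> = emeasure lborel (cis -` B \<inter> {0..<2 * pi})"
    by (rule emeasure_restrict_space) auto
  also have "cis -` B \<inter> {0..<2 * pi} = {t \<in> {0..<2 * pi}. cis t \<in> B}"
    by auto
  finally show ?thesis .
qed

lemma emeasure_circle_lebesgue_space: "emeasure circle_lebesgue unit_circle = ennreal (2 * pi)"
proof -
  have "unit_circle \<in> sets circle_borel"
    using sets.top[of circle_borel] by (simp add: space_restrict_space)
  moreover have "{t \<in> {0..<2 * pi}. cis t \<in> unit_circle} = {0..<2 * pi}"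
    by (auto simp: dist_norm)
  ultimately show ?thesis
    by (simp add: emeasure_circle_lebesgue)
qed

end

theory Submission
  imports Defs "HOL-Probability.Probability_Measure"
begin

text \<open>
  The function \<open>\<theta>\<close> is \<open>exp (- H)\<close>, where \<open>H\<close> is the Herglotz integral of a singular measure \<open>\<nu>\<close>. If absolutely
  continuous measures with Herglotz integrals \<open>H\<^sub>n\<close> approach \<open>\<nu>\<close>, then \<open>\<theta> * exp H\<^sub>n\<close> tends to \<open>1\<close>
  on the disk, and its modulus is \<open>exp (Re (H\<^sub>n - H))\<close>. So what has to be arranged is that
  \<open>Re (H\<^sub>n - H)\<close> stays below \<open>ln (1 / w)\<close>. As \<open>Re H \<ge> 0\<close>, two bounds give this: \<open>Re H\<^sub>n \<le> 2 ^ n\<close>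
  everywhere, which is enough outside a disk of radius \<open>\<rho> n\<close> where \<open>w\<close> is already below \<open>exp (- 2 ^ n)\<close>,
  and closeness of \<open>H\<^sub>n\<close> to \<open>H\<close> inside that disk, within the positive constant \<open>ln (1 / w 0)\<close>.

  Both bounds hold for a Cantor-type measure. For a uniform variable \<open>u\<close> on \<open>[0, 1)\<close>, erase the binary
  digits of \<open>u\<close> at a sparse sequence of positions, given by \<open>m\<close>; \<open>\<nu>\<close> is the law of \<open>cis (2 * pi * x)\<close>
  for the resulting \<open>x\<close>, and the \<open>n\<close>-th approximant erases only the first \<open>n\<close> of these digits. Each
  erasure at most doubles the density (\<open>nn_integral_clear_bit_le\<close>), whence the bound \<open>2 ^ n\<close>
  (\<open>Re_herglotz_clear_bits_le\<close>), whatever the positions are. The later erasures move every point by at most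
  \<open>1 / 2 ^ m n\<close> (\<open>clear_bits_dist\<close>), so by the Lipschitz bound \<open>herglotz_diff_le\<close> the approximants are as
  close to the limit on the disk of radius \<open>\<rho> n\<close> as desired if \<open>m n\<close> is large. Because \<open>\<rho> n\<close> depends on \<open>w\<close>
  and \<open>n\<close> only, the sequence \<open>m\<close> can be chosen afterwards. The numbers in which infinitely many prescribed
  digits are \<open>0\<close> form a null set (\<open>emeasure_cleared_set\<close>), so \<open>\<nu>\<close> is singular.

  To get polynomials, \<open>H\<^sub>n\<close> is dilated slightly and replaced by a partial sum of its power series, and then
  \<open>exp\<close> by a partial sum of the exponential series. The first error is absorbed into the exponent;
  the second is at most \<open>1\<close>, which accounts for the constant \<open>2\<close> instead of \<open>1\<close>.
\<close>

section \<open>Clearing binary digits\<close>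

text \<open>Replaces the binary digit of \<open>x\<close> at place value \<open>2 ^ - (m + 1)\<close> by \<open>0\<close>. The index is shifted by one so
  that \<open>m\<close> counts the fractional digits in front of it, which stay as they are.\<close>

definition clear_bit :: "nat \<Rightarrow> real \<Rightarrow> real" where
  "clear_bit m x = x - (if odd \<lfloor>2 ^ Suc m * x\<rfloor> then 1 / 2 ^ Suc m else 0)"

lemma floor_pow2_coarsen:
  fixes x y :: real
  assumes "\<lfloor>2 ^ k * x\<rfloor> = \<lfloor>2 ^ k * y\<rfloor>" and "i \<le> k"
  shows "\<lfloor>2 ^ i * x\<rfloor> = \<lfloor>2 ^ i * y\<rfloor>"
proof -
  have "\<lfloor>2 ^ i * z\<rfloor> = \<lfloor>2 ^ k * z\<rfloor> div 2 ^ (k - i)" for z :: real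
  proof -
    have "(2::real) ^ k = 2 ^ (k - i) * 2 ^ i"
      using \<open>i \<le> k\<close> by (simp flip: power_add)
    then have "2 ^ i * z = 2 ^ k * z / real_of_int (2 ^ (k - i))"
      by simp
    then show ?thesis
      using floor_divide_real_eq_div[of "2 ^ (k - i)" "2 ^ k * z"] by simp
  qed
  then show ?thesis
    using assms by simp
qed

lemma even_floor_clear_bit: "even \<lfloor>2 ^ Suc m * clear_bit m x\<rfloor>"
proof -
  have "2 ^ Suc m * clear_bit m x =
      2 ^ Suc m * x - (if odd \<lfloor>2 ^ Suc m * x\<rfloor> then 1 else 0)"
    by (simp add: clear_bit_def right_diff_distrib)
  then show ?thesis
    by (auto simp del: power_Suc)
qed

lemma floor_clear_bit: "\<lfloor>2 ^ m * clear_bit m x\<rfloor> = \<lfloor>2 ^ m * x\<rfloor>"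
proof -
  have half: "\<lfloor>2 ^ m * z\<rfloor> = \<lfloor>2 ^ Suc m * z\<rfloor> div 2" for z :: real
    using floor_divide_real_eq_div[of 2 "2 ^ Suc m * z"] by simp
  have "2 ^ Suc m * clear_bit m x =
      2 ^ Suc m * x - (if odd \<lfloor>2 ^ Suc m * x\<rfloor> then 1 else 0)"
    by (simp add: clear_bit_def right_diff_distrib)
  then have "\<lfloor>2 ^ Suc m * clear_bit m x\<rfloor> =
      \<lfloor>2 ^ Suc m * x\<rfloor> - (if odd \<lfloor>2 ^ Suc m * x\<rfloor> then 1 else 0)"
    by (auto simp del: power_Suc)
  then have "\<lfloor>2 ^ Suc m * clear_bit m x\<rfloor> div 2 = \<lfloor>2 ^ Suc m * x\<rfloor> div 2"
    by (auto simp del: power_Suc elim!: oddE)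
  then show ?thesis
    by (simp only: half)
qed

lemma clear_bit_le: "clear_bit m x \<le> x"
  by (simp add: clear_bit_def)

primrec clear_bits :: "(nat \<Rightarrow> nat) \<Rightarrow> nat \<Rightarrow> real \<Rightarrow> real" where
  "clear_bits m 0 x = x"
| "clear_bits m (Suc n) x = clear_bit (m n) (clear_bits m n x)"

definition clear_all_bits :: "(nat \<Rightarrow> nat) \<Rightarrow> real \<Rightarrow> real" where
  "clear_all_bits m x = lim (\<lambda>n. clear_bits m n x)"

lemma decseq_clear_bits: "decseq (\<lambda>n. clear_bits m n x)"
  by (rule decseq_SucI) (simp add: clear_bit_le)

text \<open>The steps from the \<open>n\<close>-th on only touch digits behind the first \<open>m n\<close>, because \<open>m\<close> increases.\<close>

lemma floor_clear_bits:
  assumes "strict_mono m" and "n \<le> k"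
  shows "\<lfloor>2 ^ m n * clear_bits m k x\<rfloor> = \<lfloor>2 ^ m n * clear_bits m n x\<rfloor>"
  using \<open>n \<le> k\<close>
proof (induction k rule: dec_induct)
  case (step k)
  have "m n \<le> m k"
    using assms(1) step by (simp add: strict_mono_less_eq)
  from floor_pow2_coarsen[OF floor_clear_bit this] step show ?case
    by simp
qed simp

lemma clear_all_bits_LIMSEQ:
  assumes "strict_mono m"
  shows "(\<lambda>n. clear_bits m n x) \<longlonglongrightarrow> clear_all_bits m x"
proof -
  have "\<lfloor>2 ^ m 0 * clear_bits m n x\<rfloor> = \<lfloor>2 ^ m 0 * x\<rfloor>" for n
    using floor_clear_bits[OF assms, of 0 n x] by simp
  then have "of_int \<lfloor>2 ^ m 0 * x\<rfloor> / 2 ^ m 0 \<le> clear_bits m n x" for n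
    using of_int_floor_le[of "2 ^ m 0 * clear_bits m n x"] by (simp add: field_simps)
  then obtain L where "(\<lambda>n. clear_bits m n x) \<longlonglongrightarrow> L"
    using decseq_convergent[OF decseq_clear_bits] by blast
  then show ?thesis
    by (simp add: clear_all_bits_def limI)
qed

lemma clear_all_bits_le:
  assumes "strict_mono m"
  shows "clear_all_bits m x \<le> clear_bits m n x"
  by (rule decseq_ge[OF decseq_clear_bits clear_all_bits_LIMSEQ[OF assms]])

text \<open>A floor is not continuous, so it need not pass to the limit of a general sequence. It does here
  because the sequence decreases and \<open>\<lfloor>_\<rfloor>\<close> is continuous from the right.\<close>

lemma floor_limit_clear_bits:
  assumes m: "strict_mono m" and const: "\<And>k. k \<ge> n \<Longrightarrow> \<lfloor>2 ^ i * clear_bits m k x\<rfloor> = q"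
  shows "\<lfloor>2 ^ i * clear_all_bits m x\<rfloor> = q"
proof (rule floor_unique)
  have "of_int q / 2 ^ i \<le> clear_bits m k x" if "k \<ge> n" for k
    using const[OF that] of_int_floor_le[of "2 ^ i * clear_bits m k x"] by (simp add: field_simps)
  then have "of_int q / 2 ^ i \<le> clear_all_bits m x"
    by (intro LIMSEQ_le_const[OF clear_all_bits_LIMSEQ[OF m]]) blast
  then show "of_int q \<le> 2 ^ i * clear_all_bits m x"
    by (simp add: field_simps)
  have "2 ^ i * clear_all_bits m x \<le> 2 ^ i * clear_bits m n x"
    using clear_all_bits_le[OF m] by simp
  also have "\<dots> < of_int q + 1"
    using const[of n] by linarith
  finally show "2 ^ i * clear_all_bits m x < of_int q + 1" .
qed

lemma floor_clear_all_bits: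
  assumes "strict_mono m"
  shows "\<lfloor>2 ^ m n * clear_all_bits m x\<rfloor> = \<lfloor>2 ^ m n * clear_bits m n x\<rfloor>"
  using floor_limit_clear_bits[OF assms] floor_clear_bits[OF assms] by blast

lemma even_floor_clear_all_bits:
  assumes m: "strict_mono m"
  shows "even \<lfloor>2 ^ Suc (m n) * clear_all_bits m x\<rfloor>"
proof -
  have "Suc (m n) \<le> m (Suc n)"
    using m by (simp add: strict_mono_def Suc_leI)
  then have "\<lfloor>2 ^ Suc (m n) * clear_all_bits m x\<rfloor> = \<lfloor>2 ^ Suc (m n) * clear_bits m (Suc n) x\<rfloor>"
    using floor_clear_all_bits[OF m] floor_pow2_coarsen by blast
  then show ?thesis
    using even_floor_clear_bit by simp
qed

text \<open>The two numbers share their integer part and their first \<open>m n\<close> fractional digits.\<close>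

lemma clear_bits_dist:
  assumes m: "strict_mono m"
  shows "\<bar>clear_bits m n x - clear_all_bits m x\<bar> \<le> 1 / 2 ^ m n"
proof -
  have "2 ^ m n * clear_bits m n x < 2 ^ m n * clear_all_bits m x + 1"
    using floor_clear_all_bits[OF m, of n x] by linarith
  then have "clear_bits m n x \<le> clear_all_bits m x + 1 / 2 ^ m n"
    by (simp add: field_simps)
  then show ?thesis
    using clear_all_bits_le[OF m, of x n] by simp
qed

lemma clear_bits_in_unit:
  assumes "strict_mono m" "u \<in> {0..<1}"
  shows "clear_bits m n u \<in> {0..<1}" "clear_all_bits m u \<in> {0..<1}"
proof -
  have "\<lfloor>clear_bits m n u\<rfloor> = \<lfloor>u\<rfloor>" "\<lfloor>clear_all_bits m u\<rfloor> = \<lfloor>u\<rfloor>"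
    using floor_pow2_coarsen[OF floor_clear_bits[OF assms(1), of 0 n u], of 0]
      floor_pow2_coarsen[OF floor_clear_all_bits[OF assms(1), of 0 u], of 0]
    by simp_all
  moreover have "\<lfloor>u\<rfloor> = 0"
    using assms(2) by (simp add: floor_eq_iff)
  ultimately show "clear_bits m n u \<in> {0..<1}" "clear_all_bits m u \<in> {0..<1}"
    by (simp_all add: floor_eq_iff)
qed

section \<open>Distribution of the modified uniform variable\<close>

abbreviation unif :: "real measure" where "unif \<equiv> restrict_space lborel {0..<1}"

lemma measurable_clear_bit [measurable]: "clear_bit m \<in> borel_measurable borel"
  unfolding clear_bit_def by measurable

lemma measurable_clear_bits [measurable]: "clear_bits m n \<in> borel_measurable borel"
  by (induction n) (auto intro: measurable_compose[OF _ measurable_clear_bit])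

lemma measurable_clear_all_bits [measurable]:
  "clear_all_bits m \<in> borel_measurable borel"
  unfolding clear_all_bits_def by measurable

text \<open>Clearing a digit at most doubles the density: \<open>clear_bit m u\<close> is either \<open>u\<close> or its translate by
  \<open>- 1 / 2 ^ (m + 1)\<close>, so \<open>g (clear_bit m u)\<close> is at most the sum of the two values of \<open>g\<close>, and
  translation preserves Lebesgue measure.\<close>

lemma nn_integral_clear_bit_le:
  fixes g :: "real \<Rightarrow> ennreal"
  assumes [measurable]: "g \<in> borel_measurable borel"
  shows "(\<integral>\<^sup>+ u. g (clear_bit m u) \<partial>unif) \<le> 2 * (\<integral>\<^sup>+ u. g u \<partial>unif)"
proof -
  let ?c = "1 / 2 ^ Suc m :: real"
  let ?g = "\<lambda>u. g u * indicator {0..<1} u"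
  have mem: "clear_bit m u \<in> {0..<1}" if "u \<in> {0..<1}" for u
  proof -
    have "\<lfloor>2 ^ 0 * clear_bit m u\<rfloor> = \<lfloor>2 ^ 0 * u\<rfloor>"
      using floor_clear_bit by (rule floor_pow2_coarsen) simp
    moreover have "\<lfloor>u\<rfloor> = 0"
      using that by (simp add: floor_eq_iff)
    ultimately show ?thesis
      by (simp add: floor_eq_iff)
  qed
  have "(\<integral>\<^sup>+ u. g (clear_bit m u) \<partial>unif) = (\<integral>\<^sup>+ u. g (clear_bit m u) * indicator {0..<1} u \<partial>lborel)"
    by (simp add: nn_integral_restrict_space)
  also have "\<dots> \<le> (\<integral>\<^sup>+ u. ?g u + ?g (- ?c + 1 * u) \<partial>lborel)"
  proof (rule nn_integral_mono)
    fix u :: real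
    have "clear_bit m u = u \<or> clear_bit m u = - ?c + 1 * u"
      by (simp add: clear_bit_def)
    then show "g (clear_bit m u) * indicator {0..<1} u \<le> ?g u + ?g (- ?c + 1 * u)"
      using mem[of u] by (auto simp: indicator_def)
  qed
  also have "\<dots> = (\<integral>\<^sup>+ u. ?g u \<partial>lborel) + (\<integral>\<^sup>+ u. ?g (- ?c + 1 * u) \<partial>lborel)"
    by (rule nn_integral_add) measurable
  also have "(\<integral>\<^sup>+ u. ?g (- ?c + 1 * u) \<partial>lborel) = (\<integral>\<^sup>+ u. ?g u \<partial>lborel)"
    using nn_integral_real_affine[of ?g 1 "- ?c"] by simp
  also have "(\<integral>\<^sup>+ u. ?g u \<partial>lborel) = (\<integral>\<^sup>+ u. g u \<partial>unif)"
    by (simp add: nn_integral_restrict_space)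
  finally show ?thesis
    by (simp add: mult_2)
qed

lemma nn_integral_clear_bits_le:
  fixes g :: "real \<Rightarrow> ennreal"
  assumes "g \<in> borel_measurable borel"
  shows "(\<integral>\<^sup>+ u. g (clear_bits m n u) \<partial>unif) \<le> 2 ^ n * (\<integral>\<^sup>+ u. g u \<partial>unif)"
  using assms
proof (induction n arbitrary: g)
  case (Suc n)
  have [measurable]: "g \<in> borel_measurable borel" by fact
  have "(\<integral>\<^sup>+ u. g (clear_bits m (Suc n) u) \<partial>unif)
      \<le> 2 ^ n * (\<integral>\<^sup>+ u. g (clear_bit (m n) u) \<partial>unif)"
    using Suc.IH[of "\<lambda>u. g (clear_bit (m n) u)"] by simp
  also have "\<dots> \<le> 2 ^ n * (2 * (\<integral>\<^sup>+ u. g u \<partial>unif))"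
    by (intro mult_left_mono nn_integral_clear_bit_le) auto
  finally show ?case
    by (simp add: mult_ac)
qed simp

text \<open>Contains the range of the limit map on \<open>[0, 1)\<close>. Being described by digits, and not as an image, it is visibly
  Borel.\<close>

definition cleared_set :: "(nat \<Rightarrow> nat) \<Rightarrow> real set" where
  "cleared_set m = {x \<in> {0..<1}. \<forall>n. even \<lfloor>2 ^ Suc (m n) * x\<rfloor>}"

lemma measurable_cleared_set [measurable]: "cleared_set m \<in> sets borel"
  unfolding cleared_set_def by measurable

lemma emeasure_lborel_translate:
  fixes A :: "real set"
  assumes [measurable]: "A \<in> sets borel"
  shows "emeasure lborel ((\<lambda>x. x + c) ` A) = emeasure lborel A"
proof -
  have "(\<lambda>x. x + c) ` A = {x. x - c \<in> A}" by force
  moreover have "emeasure lborel {x. x - c \<in> A} = (\<integral>\<^sup>+ x. indicator {x. x - c \<in> A} x \<partial>lborel)"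
    by simp
  moreover have "\<dots> = (\<integral>\<^sup>+ x. indicator A (- c + 1 * x) \<partial>lborel)"
    by (intro nn_integral_cong) (simp split: split_indicator)
  moreover have "\<dots> = (\<integral>\<^sup>+ x. indicator A x \<partial>lborel)"
    using nn_integral_real_affine[of "indicator A" 1 "- c"] by simp
  ultimately show ?thesis by simp
qed

text \<open>Setting the \<open>k\<close>-th selected digit of every element to \<open>1\<close> translates the set by
  \<open>1 / 2 ^ (m k + 1)\<close>. These infinitely many translates are pairwise disjoint, since the position of the
  digit \<open>1\<close> tells them apart, and they all lie in \<open>[0, 2]\<close>; as they have the same measure, it is \<open>0\<close>.\<close>

lemma emeasure_cleared_set:
  assumes m: "strict_mono m"
  shows "emeasure lborel (cleared_set m) = 0"
proof -
  let ?E = "cleared_set m"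
  define T where "T k = (\<lambda>x. x + 1 / 2 ^ Suc (m k)) ` ?E" for k
  have floor_add: "\<lfloor>2 ^ Suc i * (x + 1 / 2 ^ Suc i)\<rfloor> = \<lfloor>2 ^ Suc i * x\<rfloor> + 1" for i and x :: real
    by (simp add: ring_distribs del: power_Suc)
  have oddT: "odd \<lfloor>2 ^ Suc (m k) * y\<rfloor>" if "y \<in> T k" for y k
    using that floor_add by (auto simp: T_def cleared_set_def simp del: power_Suc)
  have evenT: "even \<lfloor>2 ^ Suc (m j) * y\<rfloor>" if y: "y \<in> T k" and "j < k" for y j k
  proof -
    obtain x where x: "x \<in> ?E" "y = x + 1 / 2 ^ Suc (m k)"
      using y unfolding T_def by blast
    then have "even \<lfloor>2 ^ Suc (m k) * x\<rfloor>"
      by (simp add: cleared_set_def)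
    then have "clear_bit (m k) y = x"
      unfolding clear_bit_def x floor_add by simp
    then have "\<lfloor>2 ^ m k * x\<rfloor> = \<lfloor>2 ^ m k * y\<rfloor>"
      using floor_clear_bit by metis
    moreover have "Suc (m j) \<le> m k"
      using m \<open>j < k\<close> by (simp add: strict_mono_def Suc_leI)
    ultimately have "\<lfloor>2 ^ Suc (m j) * x\<rfloor> = \<lfloor>2 ^ Suc (m j) * y\<rfloor>"
      by (rule floor_pow2_coarsen)
    moreover have "even \<lfloor>2 ^ Suc (m j) * x\<rfloor>"
      using x(1) by (simp add: cleared_set_def)
    ultimately show ?thesis
      by (simp only:)
  qed
  have disj: "disjoint_family T"
    unfolding disjoint_family_on_def
  proof (intro ballI impI)
    fix j k :: nat
    assume "j \<noteq> k"
    have False if "y \<in> T j" "y \<in> T k" for y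
      using \<open>j \<noteq> k\<close> oddT[OF that(1)] oddT[OF that(2)] evenT[OF that(1), of k] evenT[OF that(2), of j]
      by (metis linorder_neqE_nat)
    then show "T j \<inter> T k = {}"
      by (auto simp only:)
  qed
  have T_sets: "T k \<in> sets borel" for k
  proof -
    have "T k = {x. x - 1 / 2 ^ Suc (m k) \<in> ?E}"
      unfolding T_def by force
    also have "\<dots> \<in> sets borel" by measurable
    finally show ?thesis .
  qed
  have T_eq: "emeasure lborel (T k) = emeasure lborel ?E" for k
    unfolding T_def by (rule emeasure_lborel_translate) measurable
  have "(\<Sum>k. emeasure lborel ?E) = emeasure lborel (\<Union>k. T k)"
    using suminf_emeasure[OF _ disj, of lborel] T_sets by (simp add: T_eq image_subset_iff)
  also have "\<dots> \<le> emeasure lborel {0..2::real}"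
  proof (rule emeasure_mono)
    show "(\<Union>k. T k) \<subseteq> {0..2}"
    proof
      fix y assume "y \<in> (\<Union>k. T k)"
      then obtain k where "y \<in> T k" by blast
      then obtain x where x: "x \<in> ?E" "y = x + 1 / 2 ^ Suc (m k)"
        unfolding T_def by (rule imageE)
      then have "0 \<le> x" "x < 1"
        by (auto simp only: cleared_set_def mem_Collect_eq atLeastLessThan_iff)
      moreover have "0 \<le> (1::real) / 2 ^ Suc (m k)" "(1::real) / 2 ^ Suc (m k) \<le> 1"
        using one_le_power[of "2::real" "Suc (m k)"] by (simp_all add: divide_le_eq_1 del: power_Suc)
      ultimately have "0 \<le> y" "y \<le> 2"
        unfolding x(2) by linarith+
      then show "y \<in> {0..2}" by simp
    qed
  qed simp
  finally have fin: "(\<Sum>k::nat. emeasure lborel ?E) < \<infinity>"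
    by (simp add: le_less_trans)
  have "emeasure lborel ?E \<le> emeasure lborel {0..1::real}"
    by (rule emeasure_mono) (auto simp: cleared_set_def)
  then obtain r where r: "emeasure lborel ?E = ennreal r" "r \<ge> 0"
    by (cases "emeasure lborel ?E") (auto simp: top_unique)
  then have "summable (\<lambda>k::nat. r)"
    using fin by (intro summable_suminf_not_top) auto
  then show ?thesis
    by (simp add: summable_const_iff r)
qed

section \<open>A singular measure on the circle\<close>

lemma measurable_Arg2pi [measurable]: "Arg2pi \<in> borel_measurable borel"
  using open_Arg2pi2pi_gt by (auto simp: borel_measurable_iff_halfspace_greater intro: borel_open)

lemma Arg2pi_cis: "\<lbrakk>0 \<le> t; t < 2 * pi\<rbrakk> \<Longrightarrow> Arg2pi (cis t) = t"
  using Arg2pi_exp[of "\<i> * of_real t"] by (simp add: cis_conv_exp)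

lemma measurable_cis_circle_borel:
  assumes [measurable]: "X \<in> borel_measurable borel"
  shows "(\<lambda>u. cis (X u)) \<in> unif \<rightarrow>\<^sub>M circle_borel"
proof (rule measurable_restrict_space2)
  show "(\<lambda>u. cis (X u)) \<in> space unif \<rightarrow> unit_circle"
    by (auto simp: dist_norm)
  have [measurable]: "cis \<in> borel_measurable borel"
    by (simp add: borel_measurable_continuous_onI continuous_intros)
  show "(\<lambda>u. cis (X u)) \<in> unif \<rightarrow>\<^sub>M borel"
    by (rule measurable_restrict_space1) measurable
qed

text \<open>A Cantor-type measure: the law of a uniform point of the circle after the binary digits of its
  normalised angle at the selected positions have been erased.\<close>

definition cleared_measure :: "(nat \<Rightarrow> nat) \<Rightarrow> complex measure" where
  "cleared_measure m = distr unif circle_borel (\<lambda>u. cis (2 * pi * clear_all_bits m u))"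

lemma prob_space_unif: "prob_space unif"
  by (rule prob_spaceI) (simp add: emeasure_restrict_space)

lemma measure_unif [simp]: "measure unif {0..<1} = 1"
  by (simp add: measure_restrict_space)

lemma null_sets_cleared_angles:
  assumes m: "strict_mono m"
  shows "emeasure lborel {t \<in> {0..<2 * pi}. t / (2 * pi) \<in> cleared_set m} = 0"
proof -
  have "0 = (\<integral>\<^sup>+ x. indicator (cleared_set m) x \<partial>lborel)"
    using emeasure_cleared_set[OF m] by simp
  also have "\<dots> = ennreal (1 / (2 * pi)) * (\<integral>\<^sup>+ t. indicator (cleared_set m) (0 + 1 / (2 * pi) * t) \<partial>lborel)"
    using nn_integral_real_affine[of "indicator (cleared_set m)" "1 / (2 * pi)" 0] by simp
  also have "(\<integral>\<^sup>+ t. indicator (cleared_set m) (0 + 1 / (2 * pi) * t) \<partial>lborel)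
      = (\<integral>\<^sup>+ t. indicator {t. t / (2 * pi) \<in> cleared_set m} t \<partial>lborel)"
    by (intro nn_integral_cong) (simp split: split_indicator)
  also have "\<dots> = emeasure lborel {t. t / (2 * pi) \<in> cleared_set m}"
    by (rule nn_integral_indicator) measurable
  finally have "emeasure lborel {t. t / (2 * pi) \<in> cleared_set m} = 0"
    by simp
  moreover have "emeasure lborel {t \<in> {0..<2 * pi}. t / (2 * pi) \<in> cleared_set m}
      \<le> emeasure lborel {t. t / (2 * pi) \<in> cleared_set m}"
    by (rule emeasure_mono) auto
  ultimately show ?thesis by simp
qed

text \<open>The measure is carried by the points whose normalised angle lies in the null set
  \<open>cleared_set m\<close>. This carrier is a preimage under the Borel function \<open>Arg2pi\<close>, so it is Borel; as
  an image under \<open>cis\<close> it would need an argument.\<close>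

lemma singular_cleared_measure:
  assumes m: "strict_mono m"
  shows "singular_circle_measure (cleared_measure m)"
proof -
  let ?X = "\<lambda>u. cis (2 * pi * clear_all_bits m u)"
  let ?\<nu> = "cleared_measure m"
  have X: "?X \<in> unif \<rightarrow>\<^sub>M circle_borel"
    by (rule measurable_cis_circle_borel) measurable
  have prob: "prob_space ?\<nu>"
    unfolding cleared_measure_def by (rule prob_space.prob_space_distr[OF prob_space_unif X])
  have sets: "sets ?\<nu> = sets circle_borel" and space: "space ?\<nu> = unit_circle"
    by (simp_all add: cleared_measure_def space_restrict_space)
  define C where "C = {\<zeta> \<in> unit_circle. Arg2pi \<zeta> / (2 * pi) \<in> cleared_set m}"
  have C: "C \<in> sets circle_borel"
  proof -
    have "C = {\<zeta>. Arg2pi \<zeta> / (2 * pi) \<in> cleared_set m} \<inter> unit_circle"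
      by (auto simp: C_def)
    moreover have "{\<zeta>. Arg2pi \<zeta> / (2 * pi) \<in> cleared_set m} \<in> sets borel"
      by measurable
    ultimately show ?thesis
      by (auto simp: sets_restrict_space)
  qed
  have "emeasure ?\<nu> (unit_circle - C) = 0"
  proof -
    have D: "unit_circle - C \<in> sets circle_borel"
      using sets.compl_sets[OF C] by (simp add: space_restrict_space)
    have in_C: "?X u \<in> C" if u: "u \<in> {0..<1}" for u
    proof -
      have x: "clear_all_bits m u \<in> {0..<1}"
        by (rule clear_bits_in_unit[OF m u])
      then have "2 * pi * clear_all_bits m u < 2 * pi * 1"
        by (intro mult_strict_left_mono) auto
      then have "Arg2pi (?X u) = 2 * pi * clear_all_bits m u"
        using x by (intro Arg2pi_cis) auto
      then show ?thesis
        using x even_floor_clear_all_bits[OF m, of _ u]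
        by (simp add: C_def cleared_set_def dist_norm del: power_Suc)
    qed
    have "?X -` (unit_circle - C) \<inter> space unif = {}"
      using in_C by (auto simp: space_restrict_space)
    then show ?thesis
      unfolding cleared_measure_def by (simp add: emeasure_distr[OF X D])
  qed
  moreover have "emeasure circle_lebesgue C = 0"
  proof -
    have "{t \<in> {0..<2 * pi}. cis t \<in> C} = {t \<in> {0..<2 * pi}. t / (2 * pi) \<in> cleared_set m}"
      by (auto simp: C_def Arg2pi_cis dist_norm)
    then show ?thesis
      using null_sets_cleared_angles[OF m] by (simp add: emeasure_circle_lebesgue[OF C])
  qed
  moreover have "unit_circle - (unit_circle - C) = C"
    by (auto simp: C_def)
  moreover have "unit_circle - C \<in> sets ?\<nu>"
    using sets.compl_sets[OF C] by (simp add: sets space_restrict_space)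
  ultimately have "mutually_singular ?\<nu> circle_lebesgue"
    unfolding mutually_singular_def using sets by auto
  then show ?thesis
    using sets prob_space.emeasure_space_1[OF prob] prob_space.finite_measure[OF prob]
    by (simp add: singular_circle_measure_def)
qed

section \<open>Herglotz transforms\<close>

text \<open>The Herglotz integral of the law of \<open>cis (2 * pi * X)\<close>, with \<open>X\<close> a function of a uniform variable.
  Writing it on the common space \<open>unif\<close> lets two such laws be compared by comparing the variables
  pointwise.\<close>

definition herglotz :: "(real \<Rightarrow> real) \<Rightarrow> complex \<Rightarrow> complex" where
  "herglotz X z = (LINT u|unif. (cis (2 * pi * X u) + z) / (cis (2 * pi * X u) - z))"

lemma singular_S_cleared_measure:
  "singular_S (cleared_measure m) z = exp (- herglotz (clear_all_bits m) z)"
proof -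
  have "(LINT \<zeta>|cleared_measure m. (\<zeta> + z) / (\<zeta> - z)) = herglotz (clear_all_bits m) z"
    unfolding cleared_measure_def herglotz_def
    by (rule integral_distr)
      (auto intro: measurable_cis_circle_borel measurable_restrict_space1)
  then show ?thesis
    by (simp add: singular_S_def)
qed

lemma norm_circle_diff_ge: "norm \<zeta> = 1 \<Longrightarrow> 1 - norm z \<le> norm (\<zeta> - z)" for \<zeta> z :: complex
  using norm_triangle_ineq2[of \<zeta> z] by simp

lemma kernel_norm_le:
  fixes \<zeta> z :: complex
  assumes "norm \<zeta> = 1" "norm z < 1"
  shows "norm ((\<zeta> + z) / (\<zeta> - z)) \<le> 2 / (1 - norm z)"
  unfolding norm_divide
  using assms norm_triangle_ineq[of \<zeta> z] norm_circle_diff_ge[of \<zeta> z]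
  by (intro frac_le) auto

lemma integrable_unif_bounded:
  fixes f :: "real \<Rightarrow> complex"
  assumes "f \<in> borel_measurable borel" "\<And>u. norm (f u) \<le> B"
  shows "integrable unif f"
proof -
  interpret prob_space unif by (rule prob_space_unif)
  show ?thesis
    using assms by (intro integrable_const_bound[where B = B] measurable_restrict_space1) auto
qed

lemma norm_integral_unif_le:
  fixes f :: "real \<Rightarrow> complex"
  assumes f: "f \<in> borel_measurable borel" and B: "\<And>u. norm (f u) \<le> B"
  shows "norm (LINT u|unif. f u) \<le> B"
proof -
  interpret prob_space unif by (rule prob_space_unif)
  have "norm (LINT u|unif. f u) \<le> (LINT u|unif. norm (f u))"
    by (rule integral_norm_bound)
  also have "\<dots> \<le> (LINT u|unif. B)"
    using integrable_unif_bounded[OF assms] B by (intro integral_mono) auto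
  finally show ?thesis by (simp add: prob_space)
qed

lemma measurable_cis_comp [measurable]:
  "X \<in> borel_measurable M \<Longrightarrow> (\<lambda>u. cis (X u)) \<in> borel_measurable M"
  by (rule measurable_compose[where N = borel])
    (simp_all add: borel_measurable_continuous_onI continuous_intros)

lemma integrable_kernel:
  assumes [measurable]: "X \<in> borel_measurable borel" and "norm z < 1"
  shows "integrable unif (\<lambda>u. (cis (2 * pi * X u) + z) / (cis (2 * pi * X u) - z))"
proof (rule integrable_unif_bounded)
  show "(\<lambda>u. (cis (2 * pi * X u) + z) / (cis (2 * pi * X u) - z)) \<in> borel_measurable borel"
    by measurable
qed (rule kernel_norm_le, use assms in auto)

lemma kernel_diff_le:
  fixes \<zeta> \<zeta>' z z' :: complex
  assumes "norm \<zeta> = 1" "norm \<zeta>' = 1" "norm z < 1" "norm z' \<le> norm z"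
  shows "norm ((\<zeta> + z) / (\<zeta> - z) - (\<zeta>' + z') / (\<zeta>' - z'))
      \<le> 2 * (norm (\<zeta> - \<zeta>') + norm (z - z')) / (1 - norm z)\<^sup>2"
proof -
  have d: "1 - norm z \<le> norm (\<zeta> - z)" "1 - norm z \<le> norm (\<zeta>' - z')"
    using assms norm_circle_diff_ge[of \<zeta> z] norm_circle_diff_ge[of \<zeta>' z'] by auto
  then have nz: "\<zeta> - z \<noteq> 0" "\<zeta>' - z' \<noteq> 0"
    using assms(3) by auto
  have "(\<zeta> + z) / (\<zeta> - z) - (\<zeta>' + z') / (\<zeta>' - z')
      = 2 * (z * (\<zeta>' - \<zeta>) + \<zeta> * (z - z')) / ((\<zeta> - z) * (\<zeta>' - z'))"
    using nz by (simp add: divide_simps) (simp add: algebra_simps)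
  moreover have "norm (2 * (z * (\<zeta>' - \<zeta>) + \<zeta> * (z - z'))) \<le> 2 * (norm (\<zeta> - \<zeta>') + norm (z - z'))"
  proof -
    have "norm (z * (\<zeta>' - \<zeta>)) \<le> 1 * norm (\<zeta> - \<zeta>')"
      unfolding norm_mult norm_minus_commute[of \<zeta>'] using assms(3) by (intro mult_right_mono) auto
    moreover have "norm (\<zeta> * (z - z')) = norm (z - z')"
      using assms(1) by (simp add: norm_mult)
    ultimately have "norm (z * (\<zeta>' - \<zeta>) + \<zeta> * (z - z')) \<le> norm (\<zeta> - \<zeta>') + norm (z - z')"
      using norm_triangle_ineq[of "z * (\<zeta>' - \<zeta>)" "\<zeta> * (z - z')"] by linarith
    then show ?thesis
      by (simp only: norm_mult norm_numeral mult_le_cancel_left_pos zero_less_numeral)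
  qed
  moreover have "(1 - norm z)\<^sup>2 \<le> norm ((\<zeta> - z) * (\<zeta>' - z'))"
    unfolding norm_mult power2_eq_square using d assms(3) by (intro mult_mono) auto
  ultimately show ?thesis
    using assms(3) by (auto simp: norm_divide intro!: frac_le)
qed

lemma norm_cis_diff_le: "norm (cis a - cis b) \<le> \<bar>a - b\<bar>"
proof -
  have "cis a - cis b = cis b * (exp (\<i> * of_real (a - b)) - 1)"
    by (simp add: cis_conv_exp algebra_simps flip: exp_add)
  then have "norm (cis a - cis b) = 2 * \<bar>sin ((a - b) / 2)\<bar>"
    by (simp only: norm_mult norm_cis dist_exp_i_1 mult_1_left)
  also have "\<dots> \<le> 2 * \<bar>(a - b) / 2\<bar>"
    by (rule mult_left_mono[OF abs_sin_x_le_abs_x]) simp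
  finally show ?thesis by simp
qed

text \<open>Stability under moving the points of the circle and, at the same time, the evaluation point. The
  bound degenerates at the boundary only like \<open>(1 - norm z) ^ -2\<close>.\<close>

lemma herglotz_diff_le:
  assumes [measurable]: "X \<in> borel_measurable borel" "Y \<in> borel_measurable borel"
    and z: "norm z < 1" "norm z' \<le> norm z" and XY: "\<And>u. \<bar>X u - Y u\<bar> \<le> \<delta>"
  shows "norm (herglotz X z - herglotz Y z')
      \<le> 2 * (2 * pi * \<delta> + norm (z - z')) / (1 - norm z)\<^sup>2"
proof -
  let ?k = "\<lambda>X z u. (cis (2 * pi * X u) + z) / (cis (2 * pi * X u) - z)"
  have "herglotz X z - herglotz Y z' = (LINT u|unif. ?k X z u - ?k Y z' u)"
    unfolding herglotz_def using z by (intro Bochner_Integration.integral_diff[symmetric] integrable_kernel) auto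
  also have "norm \<dots> \<le> 2 * (2 * pi * \<delta> + norm (z - z')) / (1 - norm z)\<^sup>2"
  proof (rule norm_integral_unif_le)
    fix u
    have "norm (cis (2 * pi * X u) - cis (2 * pi * Y u)) \<le> \<bar>2 * pi * X u - 2 * pi * Y u\<bar>"
      by (rule norm_cis_diff_le)
    also have "\<dots> = 2 * pi * \<bar>X u - Y u\<bar>"
      by (simp add: abs_mult flip: right_diff_distrib)
    also have "\<dots> \<le> 2 * pi * \<delta>"
      using XY by (intro mult_left_mono) auto
    finally have c: "norm (cis (2 * pi * X u) - cis (2 * pi * Y u)) \<le> 2 * pi * \<delta>" .
    have "norm (?k X z u - ?k Y z' u)
        \<le> 2 * (norm (cis (2 * pi * X u) - cis (2 * pi * Y u)) + norm (z - z')) / (1 - norm z)\<^sup>2"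
      by (rule kernel_diff_le) (use z in auto)
    also have "\<dots> \<le> 2 * (2 * pi * \<delta> + norm (z - z')) / (1 - norm z)\<^sup>2"
      using c by (intro divide_right_mono mult_left_mono) auto
    finally show "norm (?k X z u - ?k Y z' u) \<le> 2 * (2 * pi * \<delta> + norm (z - z')) / (1 - norm z)\<^sup>2" .
  qed measurable
  finally show ?thesis .
qed

definition fourier_coeff :: "(real \<Rightarrow> real) \<Rightarrow> nat \<Rightarrow> complex" where
  "fourier_coeff X k = (LINT u|unif. cis (- (2 * pi * X u)) ^ k)"

text \<open>The geometric series \<open>(1 + x) / (1 - x) = -1 + 2 * (\<Sum>k. x ^ k)\<close> at \<open>x = z * cnj \<zeta>\<close>, integrated term by term,
  with the tail of the series as the error.\<close>

lemma herglotz_truncate: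
  assumes [measurable]: "X \<in> borel_measurable borel" and z: "norm z < 1"
  shows "norm (herglotz X z - (-1 + 2 * (\<Sum>k<K. fourier_coeff X k * z ^ k)))
      \<le> 2 * norm z ^ K / (1 - norm z)"
proof -
  interpret prob_space unif by (rule prob_space_unif)
  let ?c = "\<lambda>u. cis (- (2 * pi * X u))"
  let ?k = "\<lambda>u. (cis (2 * pi * X u) + z) / (cis (2 * pi * X u) - z)"
  let ?s = "\<lambda>u. -1 + 2 * (\<Sum>k<K. ?c u ^ k * z ^ k)"
  have int_c: "integrable unif (\<lambda>u. ?c u ^ k)" for k
    by (rule integrable_unif_bounded[where B = 1]) (measurable, simp add: norm_power)
  have int_s: "integrable unif ?s"
    using int_c by auto
  have "(LINT u|unif. ?s u) = -1 + 2 * (\<Sum>k<K. fourier_coeff X k * z ^ k)"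
    using int_c by (simp add: fourier_coeff_def prob_space)
  then have "herglotz X z - (-1 + 2 * (\<Sum>k<K. fourier_coeff X k * z ^ k)) = (LINT u|unif. ?k u - ?s u)"
    using integrable_kernel[OF assms] int_s by (simp add: herglotz_def)
  also have "norm \<dots> \<le> 2 * norm z ^ K / (1 - norm z)"
  proof (rule norm_integral_unif_le)
    fix u
    define x where "x = ?c u * z"
    have nx: "norm x = norm z"
      by (simp add: x_def norm_mult)
    with z have x1: "x \<noteq> 1" by auto
    have "cis (2 * pi * X u) * x = z"
      by (simp add: x_def cis_mult flip: mult.assoc)
    then have "?k u = (cis (2 * pi * X u) * (1 + x)) / (cis (2 * pi * X u) * (1 - x))"
      by (simp add: algebra_simps)
    also have "\<dots> = (1 + x) / (1 - x)"
      by (rule mult_divide_mult_cancel_left) simp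
    also have "\<dots> = -1 + 2 / (1 - x)"
      using x1 by (simp add: field_simps)
    finally have k: "?k u = -1 + 2 / (1 - x)" .
    have s: "?s u = -1 + 2 * ((1 - x ^ K) / (1 - x))"
      using x1 by (simp add: sum_gp_strict x_def flip: power_mult_distrib)
    have "?k u - ?s u = 2 * x ^ K / (1 - x)"
      unfolding k s by (simp add: diff_divide_distrib right_diff_distrib)
    moreover have "1 - norm z \<le> norm (1 - x)"
      using norm_circle_diff_ge[of 1 x] by (simp add: nx)
    ultimately show "norm (?k u - ?s u) \<le> 2 * norm z ^ K / (1 - norm z)"
      using z by (auto simp: norm_divide norm_mult norm_power nx intro!: frac_le)
  qed measurable
  finally show ?thesis .
qed

lemma fourier_coeff_uniform:
  assumes "k > 0"
  shows "fourier_coeff (\<lambda>u. u) k = 0"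
proof -
  let ?f = "\<lambda>u::real. cis (- (2 * pi * real k * u))"
  let ?F = "\<lambda>u::real. (\<i> / (2 * pi * k)) * ?f u"
  have "fourier_coeff (\<lambda>u. u) k = (LINT u|lborel. indicator {0..<1} u *\<^sub>R ?f u)"
    unfolding fourier_coeff_def by (subst integral_restrict_space) (simp_all add: Complex.DeMoivre mult_ac)
  also have "\<dots> = (LINT u|lborel. indicator {0..1} u *\<^sub>R ?f u)"
  proof (rule integral_cong_AE)
    show "AE u in lborel. indicator {0..<1} u *\<^sub>R ?f u = indicator {0..1} u *\<^sub>R ?f u"
      using AE_lborel_singleton[of "1::real"] by eventually_elim (auto simp: indicator_def)
  qed measurable
  also have "\<dots> = ?F 1 - ?F 0"
  proof (rule integral_FTC_atLeastAtMost)
    fix u :: real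
    show "(?F has_vector_derivative ?f u) (at u within {0..1})"
    proof -
      have "((\<lambda>w. \<i> / (2 * pi * k) * exp (- (\<i> * (2 * pi * k) * w))) has_field_derivative ?f u)
          (at (of_real u))"
        using \<open>k > 0\<close> by (auto intro!: derivative_eq_intros simp: cis_conv_exp mult_ac)
      from has_vector_derivative_real_field[OF this, of "{0..1}"] show ?thesis
        by (simp add: cis_conv_exp mult_ac)
    qed
  qed (auto intro!: continuous_intros)
  also have "\<dots> = 0"
  proof -
    have "?f 1 = cis (2 * pi * of_int (- int k))" by simp
    also have "\<dots> = 1" by (rule cis_multiple_2pi) auto
    finally show ?thesis by simp
  qed
  finally show ?thesis .
qed

text \<open>All Fourier coefficients of the uniform law of positive order vanish, so only the constant term of the
  series survives.\<close>

lemma herglotz_uniform: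
  assumes z: "norm z < 1"
  shows "herglotz (\<lambda>u. u) z = 1"
proof -
  interpret prob_space unif by (rule prob_space_unif)
  have sum1: "(\<Sum>k<Suc K. fourier_coeff (\<lambda>u. u) k * z ^ k) = 1" for K
    by (simp add: sum.lessThan_Suc_shift fourier_coeff_uniform del: sum.lessThan_Suc)
      (simp add: fourier_coeff_def prob_space)
  have "norm (herglotz (\<lambda>u. u) z - 1) \<le> 2 * norm z ^ Suc K / (1 - norm z)" for K
    using herglotz_truncate[of "\<lambda>u. u" z "Suc K"] z unfolding sum1 by simp
  moreover have "(\<lambda>K. 2 * norm z ^ Suc K / (1 - norm z)) \<longlonglongrightarrow> 2 * 0 / (1 - norm z)"
    using z by (intro tendsto_intros LIMSEQ_Suc[OF LIMSEQ_power_zero]) auto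
  ultimately have "norm (herglotz (\<lambda>u. u) z - 1) \<le> 0"
    by (intro LIMSEQ_le_const[where X = "\<lambda>K. 2 * norm z ^ Suc K / (1 - norm z)"]) auto
  then show ?thesis by simp
qed

lemma Re_kernel_nonneg:
  fixes \<zeta> z :: complex
  assumes "norm \<zeta> = 1" "norm z < 1"
  shows "0 \<le> Re ((\<zeta> + z) / (\<zeta> - z))"
proof -
  have "Re ((\<zeta> + z) * cnj (\<zeta> - z)) = (norm \<zeta>)\<^sup>2 - (norm z)\<^sup>2"
    by (simp add: cmod_power2) (simp add: algebra_simps power2_eq_square)
  also have "\<dots> \<ge> 0"
    using assms by (simp add: power_le_one)
  finally show ?thesis
    by (subst complex_div_cnj) (simp add: Re_divide_of_real flip: of_real_power)
qed

lemma Re_herglotz: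
  assumes "X \<in> borel_measurable borel" "norm z < 1"
  shows "ennreal (Re (herglotz X z))
      = (\<integral>\<^sup>+ u. ennreal (Re ((cis (2 * pi * X u) + z) / (cis (2 * pi * X u) - z))) \<partial>unif)"
  unfolding herglotz_def integral_Re[OF integrable_kernel[OF assms], symmetric]
  using integrable_kernel[OF assms] Re_kernel_nonneg assms(2)
  by (intro nn_integral_eq_integral[symmetric]) auto

lemma Re_herglotz_nonneg:
  assumes "X \<in> borel_measurable borel" "norm z < 1"
  shows "0 \<le> Re (herglotz X z)"
  unfolding herglotz_def integral_Re[OF integrable_kernel[OF assms], symmetric]
  using Re_kernel_nonneg assms(2) by (intro Bochner_Integration.integral_nonneg) auto

text \<open>The law of \<open>clear_bits m n\<close> has density at most \<open>2 ^ n\<close>, and the Poisson integral of the uniform law is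
  \<open>1\<close>.\<close>

lemma Re_herglotz_clear_bits_le:
  assumes z: "norm z < 1"
  shows "Re (herglotz (clear_bits m n) z) \<le> 2 ^ n"
proof -
  let ?g = "\<lambda>x::real. ennreal (Re ((cis (2 * pi * x) + z) / (cis (2 * pi * x) - z)))"
  have "ennreal (Re (herglotz (clear_bits m n) z)) = (\<integral>\<^sup>+ u. ?g (clear_bits m n u) \<partial>unif)"
    using z by (intro Re_herglotz) measurable
  also have "\<dots> \<le> 2 ^ n * (\<integral>\<^sup>+ u. ?g u \<partial>unif)"
    by (rule nn_integral_clear_bits_le) measurable
  also have "(\<integral>\<^sup>+ u. ?g u \<partial>unif) = ennreal (Re (herglotz (\<lambda>u. u) z))"
    using z by (intro Re_herglotz[symmetric]) measurable
  also have "\<dots> = 1"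
    by (simp add: herglotz_uniform[OF z])
  finally have "ennreal (Re (herglotz (clear_bits m n) z)) \<le> ennreal (2 ^ n)"
    by (simp flip: ennreal_power)
  then show ?thesis
    by (subst (asm) ennreal_le_iff) auto
qed

section \<open>Polynomial approximation and the choice of the digits\<close>

text \<open>Partial sums of the exponential series converge uniformly on the bounded set \<open>q ` cball 0 1\<close>.\<close>

lemma exp_poly_approx:
  fixes q :: "complex poly"
  assumes "e > 0"
  shows "\<exists>p. \<forall>z\<in>cball 0 1. norm (poly p z - exp (poly q z)) \<le> e"
proof -
  have "compact (poly q ` cball 0 1)"
    by (intro compact_continuous_image continuous_on_poly[OF continuous_on_id, simplified] compact_cball)
  then have "bounded (poly q ` cball 0 1)"
    by (rule compact_imp_bounded)
  then obtain R where R: "\<forall>z\<in>cball 0 1. norm (poly q z) \<le> R"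
    by (auto simp: bounded_iff)
  have "uniform_limit (cball 0 R) (\<lambda>n x :: complex. \<Sum>i<n. x ^ i /\<^sub>R fact i) exp sequentially"
    unfolding exp_def
  proof (rule Weierstrass_m_test)
    show "norm (x ^ i /\<^sub>R fact i) \<le> R ^ i /\<^sub>R fact i" if "x \<in> cball 0 R" for i and x :: complex
      using that by (auto simp: norm_power intro!: mult_left_mono power_mono)
    show "summable (\<lambda>i. R ^ i /\<^sub>R fact i)"
      by (rule summable_exp_generic)
  qed
  from uniform_limitD[OF this \<open>e > 0\<close>] obtain n where
    n: "\<forall>x::complex\<in>cball 0 R. dist (\<Sum>i<n. x ^ i /\<^sub>R fact i) (exp x) < e"
    using eventually_happens'[OF sequentially_bot] by blast
  show ?thesis
  proof (intro exI ballI)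
    fix z :: complex assume "z \<in> cball 0 1"
    then have "poly q z \<in> cball 0 R"
      using R by simp
    with n have "dist (\<Sum>i<n. poly q z ^ i /\<^sub>R fact i) (exp (poly q z)) < e"
      by blast
    then show "norm (poly (\<Sum>i<n. smult (inverse (fact i)) (q ^ i)) z - exp (poly q z)) \<le> e"
      by (simp add: poly_sum poly_power dist_norm scaleR_conv_of_real)
  qed
qed

text \<open>The dilation by \<open>r < 1\<close> makes the geometric tail uniformly small on the closed disk.\<close>

lemma herglotz_poly_approx:
  assumes X: "X \<in> borel_measurable borel" and r: "0 \<le> r" "r < 1" and "e > 0"
  shows "\<exists>q. \<forall>z\<in>cball 0 1. norm (herglotz X (of_real r * z) - poly q z) \<le> e"
proof -
  have "(\<lambda>K. 2 * r ^ K / (1 - r)) \<longlonglongrightarrow> 2 * 0 / (1 - r)"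
    using r by (intro tendsto_intros LIMSEQ_power_zero) auto
  then have "\<forall>\<^sub>F K in sequentially. 2 * r ^ K / (1 - r) < e"
    using \<open>e > 0\<close> by (intro order_tendstoD) auto
  then obtain K where K: "2 * r ^ K / (1 - r) < e"
    by (auto simp: eventually_sequentially)
  define q where "q = [:-1:] + (\<Sum>k<K. monom (2 * fourier_coeff X k * of_real r ^ k) k)"
  have "norm (herglotz X (of_real r * z) - poly q z) \<le> e" if "z \<in> cball 0 1" for z
  proof -
    have "norm z \<le> 1"
      using that by simp
    then have rz: "norm (of_real r * z) \<le> r"
      using r mult_left_le[of "norm z" r] by (simp add: norm_mult)
    have "poly q z = -1 + 2 * (\<Sum>k<K. fourier_coeff X k * (of_real r * z) ^ k)"
      by (simp add: q_def poly_sum poly_monom sum_distrib_left power_mult_distrib mult_ac)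
    then have "norm (herglotz X (of_real r * z) - poly q z)
        \<le> 2 * norm (of_real r * z) ^ K / (1 - norm (of_real r * z))"
      using herglotz_truncate[OF X, of "of_real r * z" K] rz r by simp
    also have "\<dots> \<le> 2 * r ^ K / (1 - r)"
      using rz r by (intro frac_le mult_left_mono power_mono) auto
    finally show ?thesis
      using K by simp
  qed
  then show ?thesis by blast
qed

text \<open>The polynomial \<open>q\<close> approximates the Herglotz integral after \<open>n\<close> clearings, dilated by
  \<open>1 - 1 / 2 ^ m n\<close>. The first bound does not depend on \<open>m\<close> at all; the second one becomes small on a
  prescribed smaller disk when \<open>m n\<close> is large. This separation allows the digits to be chosen
  after the disks.\<close>

lemma cleared_approximants:
  assumes m: "strict_mono m"
  shows "\<exists>q. \<forall>z\<in>unit_disk. Re (poly q z) \<le> 2 ^ n + 1 \<and>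
    norm (poly q z - herglotz (clear_all_bits m) z) \<le> 19 / (2 ^ m n * (1 - norm z)\<^sup>2)"
proof -
  let ?d = "1 / 2 ^ m n :: real"
  let ?X = "clear_bits m n" and ?Y = "clear_all_bits m"
  have d: "0 < ?d" "?d \<le> 1"
    by simp_all
  then have "\<exists>q. \<forall>z\<in>cball 0 1. norm (herglotz ?X (of_real (1 - ?d) * z) - poly q z) \<le> ?d"
    by (intro herglotz_poly_approx measurable_clear_bits) linarith+
  then obtain q where q: "\<forall>z\<in>cball 0 1. norm (herglotz ?X (of_real (1 - ?d) * z) - poly q z) \<le> ?d" ..
  have "Re (poly q z) \<le> 2 ^ n + 1 \<and>
      norm (poly q z - herglotz ?Y z) \<le> 19 / (2 ^ m n * (1 - norm z)\<^sup>2)"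
    if "z \<in> unit_disk" for z
  proof
    have z: "norm z < 1" using that by simp
    let ?z = "of_real (1 - ?d) * z"
    have nz: "norm ?z \<le> norm z"
    proof -
      have "norm (of_real (1 - ?d) :: complex) \<le> 1"
        unfolding norm_of_real using d by linarith
      then show ?thesis
        unfolding norm_mult by (intro mult_left_le_one_le) auto
    qed
    have qz: "norm (herglotz ?X ?z - poly q z) \<le> ?d"
      using q z by simp
    have "Re (poly q z) \<le> Re (herglotz ?X ?z) + ?d"
      using qz abs_Re_le_cmod[of "herglotz ?X ?z - poly q z"] by simp
    also have "\<dots> \<le> 2 ^ n + 1"
      using nz z d by (intro add_mono Re_herglotz_clear_bits_le) linarith+
    finally show "Re (poly q z) \<le> 2 ^ n + 1" .
    have "z - ?z = of_real ?d * z"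
      by (simp add: algebra_simps)
    then have zz: "norm (z - ?z) \<le> ?d"
      using z d mult_left_le[of "norm z" ?d] by (simp add: norm_mult norm_divide norm_power)
    have one: "0 < (1 - norm z)\<^sup>2" "(1 - norm z)\<^sup>2 \<le> 1"
      using z by (simp_all add: power_le_one)
    have "norm (herglotz ?Y z - herglotz ?X ?z) \<le> 2 * (2 * pi * ?d + norm (z - ?z)) / (1 - norm z)\<^sup>2"
      using clear_bits_dist[OF m] nz z by (intro herglotz_diff_le) (auto simp: abs_minus_commute)
    also have "\<dots> \<le> (18 * ?d) / (1 - norm z)\<^sup>2"
    proof (rule divide_right_mono)
      (* 18 = 2 * (2 * 4 + 1), from pi < 4 and a shift of at most ?d by the dilation *)
      have "2 * pi * ?d \<le> 8 * ?d"
        using pi_less_4 d by (intro mult_right_mono) auto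
      from add_mono[OF this zz] show "2 * (2 * pi * ?d + norm (z - ?z)) \<le> 18 * ?d"
        by simp
    qed simp
    finally have "norm (herglotz ?Y z - herglotz ?X ?z) \<le> (18 * ?d) / (1 - norm z)\<^sup>2" .
    moreover have "?d \<le> ?d / (1 - norm z)\<^sup>2"
      using one d by (simp add: pos_le_divide_eq mult_left_le)
    moreover have "norm (poly q z - herglotz ?Y z)
        \<le> norm (herglotz ?Y z - herglotz ?X ?z) + norm (herglotz ?X ?z - poly q z)"
      using norm_triangle_ineq[of "herglotz ?Y z - herglotz ?X ?z" "herglotz ?X ?z - poly q z"]
      by (simp add: norm_minus_commute)
    ultimately have "norm (poly q z - herglotz ?Y z) \<le> (18 * ?d) / (1 - norm z)\<^sup>2 + ?d / (1 - norm z)\<^sup>2"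
      using qz by linarith
    also have "\<dots> = 19 / (2 ^ m n * (1 - norm z)\<^sup>2)"
      by (simp add: add_divide_distrib[symmetric])
    finally show "norm (poly q z - herglotz ?Y z) \<le> 19 / (2 ^ m n * (1 - norm z)\<^sup>2)" .
  qed
  then show ?thesis by blast
qed

theorem corollary1p2:
  fixes w :: "real \<Rightarrow> real"
  assumes "w ` {0..<1} \<subseteq> {0<..<1}"
    and "antimono_on {0..<1} w"
    and "(w \<longlongrightarrow> 0) (at_left 1)"
  shows "\<exists>(\<theta> :: complex \<Rightarrow> complex) (p :: nat \<Rightarrow> complex poly).
           singular_inner \<theta> \<and>
           (\<forall>z\<in>unit_disk. (\<lambda>n. \<theta> z * poly (p n) z) \<longlonglongrightarrow> 1) \<and>
           (\<forall>n. (SUP z\<in>unit_disk. ereal (norm (\<theta> z * poly (p n) z) * w (norm z))) \<le> 2)"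
proof -
  have w: "0 < w t" "w t < 1" if "0 \<le> t" "t < 1" for t
    using assms(1) that by (auto simp: image_subset_iff)
  have w_mono: "w t \<le> w s" if "0 \<le> s" "s \<le> t" "t < 1" for s t
    using monotone_onD[OF assms(2), of s t] that by auto

  \<comment> \<open>Outside the disk of radius \<open>\<rho> n\<close> the weight absorbs the crude bound \<open>exp (2 ^ n + 1)\<close>.\<close>
  have "\<exists>t. 0 \<le> t \<and> t < 1 \<and> w t \<le> exp (- (2 ^ n + 1))" for n :: nat
  proof -
    have "\<forall>\<^sub>F t in at_left 1. w t < exp (- (2 ^ n + 1))"
      using assms(3) by (rule order_tendstoD) simp
    moreover have "\<forall>\<^sub>F t in at_left (1::real). t \<in> {0<..<1}"
      by (rule eventually_at_left_real) simp
    ultimately have "\<forall>\<^sub>F t in at_left 1. 0 \<le> t \<and> t < 1 \<and> w t \<le> exp (- (2 ^ n + 1))"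
      by eventually_elim auto
    then show ?thesis
      by (rule eventually_happens'[rotated]) simp
  qed
  then obtain \<rho> where \<rho>: "\<And>n. 0 \<le> \<rho> n" "\<And>n. \<rho> n < 1" "\<And>n. w (\<rho> n) \<le> exp (- (2 ^ n + 1))"
    by metis

  \<comment> \<open>On the disk of radius \<open>\<rho> n\<close> an error of \<open>\<delta>\<close> in the exponent is affordable, because
    \<open>exp \<delta> * w 0 = 1\<close> and \<open>w 0\<close> is the largest value of \<open>w\<close>.\<close>
  define \<delta> where "\<delta> = - ln (w 0)"
  have "\<delta> > 0"
    using w[of 0] by (simp add: \<delta>_def)
  have "\<exists>N. 19 / (2 ^ N * (1 - \<rho> n)\<^sup>2) \<le> \<delta>" for n
  proof -
    have pos: "0 < (1 - \<rho> n)\<^sup>2"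
      using \<rho>(2)[of n] by simp
    obtain N where "19 / (\<delta> * (1 - \<rho> n)\<^sup>2) < 2 ^ N"
      using real_arch_pow[of 2] by auto
    then have "19 / (2 ^ N * (1 - \<rho> n)\<^sup>2) \<le> \<delta>"
      using pos \<open>\<delta> > 0\<close> by (simp add: field_simps)
    then show ?thesis ..
  qed
  then obtain N where N: "\<And>n. 19 / (2 ^ N n * (1 - \<rho> n)\<^sup>2) \<le> \<delta>"
    by metis

  \<comment> \<open>Adding \<open>n\<close> and summing the thresholds makes \<open>m\<close> strictly increasing and \<open>m n \<ge> N n\<close>.\<close>
  define m where "m n = n + (\<Sum>k\<le>n. N k)" for n
  have m: "strict_mono m"
    by (auto simp: strict_mono_Suc_iff m_def)
  have "n \<le> m n" "N n \<le> m n" for n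
    using member_le_sum[of n "{..n}" N] by (auto simp: m_def)

  let ?H = "herglotz (clear_all_bits m)"
  define \<theta> where "\<theta> = singular_S (cleared_measure m)"
  have \<theta>: "\<theta> z = exp (- ?H z)" for z
    by (simp add: \<theta>_def singular_S_cleared_measure)
  have \<theta>_le: "norm (\<theta> z) \<le> 1" if "z \<in> unit_disk" for z
    using Re_herglotz_nonneg[of "clear_all_bits m" z] that by (simp add: \<theta> measurable_clear_all_bits)

  obtain q where q: "\<And>n z. z \<in> unit_disk \<Longrightarrow> Re (poly (q n) z) \<le> 2 ^ n + 1"
      "\<And>n z. z \<in> unit_disk \<Longrightarrow> norm (poly (q n) z - ?H z) \<le> 19 / (2 ^ m n * (1 - norm z)\<^sup>2)"
    using cleared_approximants[OF m] by metis
  have "\<exists>p. \<forall>z\<in>cball 0 1. norm (poly p z - exp (poly (q n) z)) \<le> 1 / Suc n" for n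
    by (rule exp_poly_approx) simp
  then obtain p where "\<And>n. \<forall>z\<in>cball 0 1. norm (poly (p n) z - exp (poly (q n) z)) \<le> 1 / Suc n"
    by metis
  then have p: "norm (poly (p n) z - exp (poly (q n) z)) \<le> 1 / Suc n" if "z \<in> unit_disk" for n z
    using that by simp
  \<comment> \<open>Separates the error of the exponential series from the error in the exponent.\<close>
  have split: "\<theta> z * poly (p n) z
      = \<theta> z * (poly (p n) z - exp (poly (q n) z)) + exp (poly (q n) z - ?H z)" for n z
    by (simp add: \<theta> right_diff_distrib exp_diff exp_minus field_simps)
  have err: "norm (\<theta> z * (poly (p n) z - exp (poly (q n) z))) \<le> 1 / Suc n" if "z \<in> unit_disk" for n z
    unfolding norm_mult using mult_mono[OF \<theta>_le[OF that] p[OF that]] by simp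

  have "singular_inner \<theta>"
    using singular_cleared_measure[OF m] by (auto simp: singular_inner_def \<theta>_def)
  moreover have "(\<lambda>n. \<theta> z * poly (p n) z) \<longlonglongrightarrow> 1" if z: "z \<in> unit_disk" for z
  proof -
    have "(\<lambda>n. \<theta> z * (poly (p n) z - exp (poly (q n) z))) \<longlonglongrightarrow> 0"
      by (rule Lim_null_comparison[OF _ LIMSEQ_Suc[OF lim_1_over_n]]) (use err[OF z] in auto)
    moreover have "(\<lambda>n. poly (q n) z - ?H z) \<longlonglongrightarrow> 0"
    proof (rule Lim_null_comparison)
      have "norm (poly (q n) z - ?H z) \<le> 19 / (1 - norm z)\<^sup>2 * (1 / 2) ^ n" for n
      proof -
        have "norm (poly (q n) z - ?H z) \<le> 19 / (2 ^ m n * (1 - norm z)\<^sup>2)"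
          by (rule q(2)[OF z])
        also have "\<dots> \<le> 19 / (2 ^ n * (1 - norm z)\<^sup>2)"
          using z \<open>n \<le> m n\<close> by (intro divide_left_mono mult_right_mono mult_pos_pos) auto
        finally show ?thesis
          by (simp add: power_divide mult.commute)
      qed
      then show "\<forall>\<^sub>F n in sequentially. norm (poly (q n) z - ?H z) \<le> 19 / (1 - norm z)\<^sup>2 * (1 / 2) ^ n"
        by simp
      show "(\<lambda>n. 19 / (1 - norm z)\<^sup>2 * (1 / 2) ^ n) \<longlonglongrightarrow> 0"
        by (intro tendsto_mult_right_zero LIMSEQ_power_zero) simp
    qed
    then have "(\<lambda>n. exp (poly (q n) z - ?H z)) \<longlonglongrightarrow> exp 0"
      by (rule tendsto_exp)
    ultimately show ?thesis
      unfolding split using tendsto_add by fastforce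
  qed
  moreover have "norm (\<theta> z * poly (p n) z) * w (norm z) \<le> 2" if z: "z \<in> unit_disk" for n z
  proof -
    have wz: "0 < w (norm z)" "w (norm z) < 1"
      using w[of "norm z"] z by auto
    have "exp (Re (poly (q n) z - ?H z)) * w (norm z) \<le> 1"
    proof (cases "norm z \<le> \<rho> n")
      case True
      have "Re (poly (q n) z - ?H z) \<le> 19 / (2 ^ m n * (1 - norm z)\<^sup>2)"
        using q(2)[OF z, of n] complex_Re_le_cmod order_trans by blast
      also have "\<dots> \<le> 19 / (2 ^ N n * (1 - \<rho> n)\<^sup>2)"
        using True z \<rho>(2)[of n] \<open>N n \<le> m n\<close>
        by (intro divide_left_mono mult_mono power_mono mult_pos_pos) auto
      also have "\<dots> \<le> \<delta>"
        by (rule N)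
      finally have "exp (Re (poly (q n) z - ?H z)) * w (norm z) \<le> exp \<delta> * w 0"
        using w_mono[of 0 "norm z"] wz z by (intro mult_mono) auto
      also have "\<dots> = 1"
        using w[of 0] by (simp add: \<delta>_def exp_minus)
      finally show ?thesis .
    next
      case False
      have "Re (poly (q n) z - ?H z) \<le> 2 ^ n + 1"
        using q(1)[OF z, of n] Re_herglotz_nonneg[of "clear_all_bits m" z] z
        by (simp add: measurable_clear_all_bits)
      moreover have "w (norm z) \<le> exp (- (2 ^ n + 1))"
        using w_mono[of "\<rho> n" "norm z"] \<rho>(1,3)[of n] False z by auto
      ultimately have "exp (Re (poly (q n) z - ?H z)) * w (norm z) \<le> exp (2 ^ n + 1) * exp (- (2 ^ n + 1))"
        using wz by (intro mult_mono) auto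
      then show ?thesis
        by (simp flip: exp_add)
    qed
    moreover have "norm (\<theta> z * (poly (p n) z - exp (poly (q n) z))) * w (norm z) \<le> 1 * 1"
    proof (rule mult_mono)
      have "1 / real (Suc n) \<le> 1" by simp
      with err[OF z, of n] show "norm (\<theta> z * (poly (p n) z - exp (poly (q n) z))) \<le> 1"
        by linarith
    qed (use wz in auto)
    moreover have "norm (\<theta> z * poly (p n) z)
        \<le> norm (\<theta> z * (poly (p n) z - exp (poly (q n) z))) + exp (Re (poly (q n) z - ?H z))"
      unfolding split[of z n] norm_exp_eq_Re[symmetric] by (rule norm_triangle_ineq)
    ultimately show ?thesis
      using mult_right_mono[of "norm (\<theta> z * poly (p n) z)" _ "w (norm z)"] wz
      by (smt (verit, best) distrib_right)
  qed
  then have "\<forall>n. (SUP z\<in>unit_disk. ereal (norm (\<theta> z * poly (p n) z) * w (norm z))) \<le> 2"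
    unfolding numeral_eq_ereal by (auto intro!: SUP_least)
  ultimately show ?thesis
    by blast
qed

end
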